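(* There exist infinitely many (pairwise non-isomorphic) $2$-connected $4$-regular graphs $G$ with $\chi_c'(G) = 5$.
   Context: Graphs are finite and simple (no loops, no parallel edges). For a real number $r$, a circular $r$-edge-colouring of $G$ is a map $c$ assigning to each edge of $G$ a real number in $[0,r)$ such that any two distinct edges $e,f$ sharing an end-vertex satisfy $1\le |c(e)-c(f)|\le r-1$. The circular chromatic index $\chi_c'(G)$ is the infimum (attained for finite graphs) of all $r$ such that $G$ admits a circular $r$-edge-colouring. "$2$-connected" refers to vertex connectivity. *)

theory Defs
  imports Complex_Main
begin

type_synonym 'a graph = "'a set \<times> 'a set set"

abbreviation verts :: "'a graph \<Rightarrow> 'a set" where
  "verts G \<equiv> fst G"

abbreviation edges :: "'a graph \<Rightarrow> 'a set set" where
  "edges G \<equiv> snd G"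

definition simple_graph :: "'a graph \<Rightarrow> bool" where
  "simple_graph G \<longleftrightarrow> finite (verts G) \<and> (\<forall>e\<in>edges G. e \<subseteq> verts G \<and> card e = 2)"

definition vertex_degree :: "'a graph \<Rightarrow> 'a \<Rightarrow> nat" where
  "vertex_degree G v = card {e \<in> edges G. v \<in> e}"

definition k_regular :: "nat \<Rightarrow> 'a graph \<Rightarrow> bool" where
  "k_regular k G \<longleftrightarrow> (\<forall>v\<in>verts G. vertex_degree G v = k)"

definition connected_graph :: "'a graph \<Rightarrow> bool" where
  "connected_graph G \<longleftrightarrow> verts G \<noteq> {} \<and>
     (\<forall>u\<in>verts G. \<forall>v\<in>verts G. (u, v) \<in> {(x, y). {x, y} \<in> edges G}\<^sup>*)"

definition delete_verts :: "'a graph \<Rightarrow> 'a set \<Rightarrow> 'a graph" where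
  "delete_verts G X = (verts G - X, {e \<in> edges G. e \<inter> X = {}})"

definition k_connected :: "nat \<Rightarrow> 'a graph \<Rightarrow> bool" where
  "k_connected k G \<longleftrightarrow> card (verts G) > k \<and>
     (\<forall>X \<subseteq> verts G. card X < k \<longrightarrow> connected_graph (delete_verts G X))"

definition graph_isomorphic :: "'a graph \<Rightarrow> 'b graph \<Rightarrow> bool" where
  "graph_isomorphic G H \<longleftrightarrow> (\<exists>f. bij_betw f (verts G) (verts H) \<and>
     (\<forall>u\<in>verts G. \<forall>v\<in>verts G. {u, v} \<in> edges G \<longleftrightarrow> {f u, f v} \<in> edges H))"

definition circular_edge_colouring :: "'a graph \<Rightarrow> real \<Rightarrow> ('a set \<Rightarrow> real) \<Rightarrow> bool" where
  "circular_edge_colouring G r c \<longleftrightarrow>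
     (\<forall>e\<in>edges G. 0 \<le> c e \<and> c e < r) \<and>
     (\<forall>e\<in>edges G. \<forall>f\<in>edges G. e \<noteq> f \<and> e \<inter> f \<noteq> {} \<longrightarrow>
        1 \<le> \<bar>c e - c f\<bar> \<and> \<bar>c e - c f\<bar> \<le> r - 1)"

(* Meaningful only for graphs with at least one edge: for an edgeless graph every real r
   qualifies, so the infimum is taken over a set that is not bounded below. *)
definition circular_chromatic_index :: "'a graph \<Rightarrow> real" where
  "circular_chromatic_index G = Inf {r. \<exists>c. circular_edge_colouring G r c}"

end

(* The graphs are rings of n >= 2 copies of K5 minus an edge, consecutive copies being joined by an
   edge between ends of the missing edges. Colouring each edge by the sum of its ends modulo 5 shows
   that r = 5 suffices. Conversely, a ring contains K5 minus an edge together with a pendant edge at one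
   end of the missing edge, and this small graph already forces r >= 5: taking floors turns a circular
   r-edge-colouring c with r < 5 into a proper 5-edge-colouring, and a finite case analysis shows that
   every such colouring has edges e0, ..., e4 of colours 0, ..., 4, each adjacent to the next,
   cyclically. Then c e4 >= c e0 + 4 > c e0 + (r - 1), although e4 and e0 are adjacent. *)

theory Submission
  imports Defs
begin

section \<open>Exhaustive search for tight cycles\<close>

definition meets :: "nat \<times> nat \<Rightarrow> nat \<times> nat \<Rightarrow> bool" where
  "meets e f \<longleftrightarrow> fst e = fst f \<or> fst e = snd f \<or> snd e = fst f \<or> snd e = snd f"

text \<open>Phrased by \<open>list_ex\<close> over a list of coloured edges so that it can be
  evaluated.\<close>

definition has_tight_cycle :: "((nat \<times> nat) \<times> nat) list \<Rightarrow> bool" where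
  "has_tight_cycle xs \<longleftrightarrow> list_ex (\<lambda>(e0, c0). c0 = 0 \<and>
     list_ex (\<lambda>(e1, c1). c1 = 1 \<and> meets e0 e1 \<and>
     list_ex (\<lambda>(e2, c2). c2 = 2 \<and> meets e1 e2 \<and>
     list_ex (\<lambda>(e3, c3). c3 = 3 \<and> meets e2 e3 \<and>
     list_ex (\<lambda>(e4, c4). c4 = 4 \<and> meets e3 e4 \<and> meets e4 e0) xs) xs) xs) xs) xs"

text \<open>The colours already chosen are kept in \<open>xs\<close>; the first disjunct prunes the
  improper branches of the search.\<close>

fun all_extensions_tight :: "(nat \<times> nat) list \<Rightarrow> ((nat \<times> nat) \<times> nat) list \<Rightarrow> bool" where
  "all_extensions_tight [] xs = has_tight_cycle xs"
| "all_extensions_tight (e # es) xs =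
     list_all (\<lambda>c. list_ex (\<lambda>(f, d). d = c \<and> meets e f) xs \<or> all_extensions_tight es ((e, c) # xs))
       [0, 1, 2, 3, 4]"

text \<open>Vertices 0 to 4 carry K5 minus the edge 01, and 5 is the pendant vertex at 1. In the
  numbering of the ring, 5 is vertex 0 of the next copy. The triangle on 2, 3, 4 comes first, so
  that clashes prune the search early.\<close>

definition pendant_K5_minus :: "(nat \<times> nat) list" where
  "pendant_K5_minus =
     [(2, 3), (2, 4), (3, 4), (1, 2), (1, 3), (1, 4), (0, 2), (0, 3), (0, 4), (1, 5)]"

lemma all_extensions_tight_pendant_K5_minus:
  "all_extensions_tight (tl pendant_K5_minus) [((2, 3), 0)]"
  by code_simp

text \<open>Soundness of the search: the values of a proper \<phi> trace a branch that is never
  pruned. Distinctness matters because \<open>meets e e\<close> holds, whereas properness only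
  compares different edges.\<close>

lemma all_extensions_tightD:
  assumes "all_extensions_tight es xs"
    and "\<forall>e\<in>set es. \<phi> e < 5"
    and "distinct (es @ map fst xs)"
    and "\<forall>(e, c)\<in>set xs. c = \<phi> e"
    and "\<forall>e\<in>set es. \<forall>f\<in>set es \<union> fst ` set xs. e \<noteq> f \<and> meets e f \<longrightarrow> \<phi> e \<noteq> \<phi> f"
  shows "has_tight_cycle (rev (map (\<lambda>e. (e, \<phi> e)) es) @ xs)"
  using assms
proof (induction es arbitrary: xs)
  case Nil
  then show ?case by simp
next
  case (Cons e es)
  have "\<phi> e \<in> set [0, 1, 2, 3, 4]"
    using Cons.prems(2) by auto
  then have "list_ex (\<lambda>(f, d). d = \<phi> e \<and> meets e f) xs \<or> all_extensions_tight es ((e, \<phi> e) # xs)"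
    using Cons.prems(1) by (auto simp: list_all_iff)
  moreover have "\<not> list_ex (\<lambda>(f, d). d = \<phi> e \<and> meets e f) xs"
  proof
    assume "list_ex (\<lambda>(f, d). d = \<phi> e \<and> meets e f) xs"
    then obtain f where f: "(f, \<phi> e) \<in> set xs" "meets e f"
      by (auto simp: list_ex_iff)
    then have "f \<in> fst ` set xs" "\<phi> f = \<phi> e" "f \<noteq> e"
      using Cons.prems(3,4) by force+
    then show False
      using Cons.prems(5) f(2) by (metis UnCI list.set_intros(1))
  qed
  ultimately have "all_extensions_tight es ((e, \<phi> e) # xs)"
    by blast
  then have "has_tight_cycle (rev (map (\<lambda>e. (e, \<phi> e)) es) @ (e, \<phi> e) # xs)"
    using Cons.prems(2-5) by (intro Cons.IH) auto
  then show ?case by simp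
qed

lemma pendant_K5_minus_tight_cycle:
  fixes \<phi> :: "nat \<times> nat \<Rightarrow> nat"
  assumes "\<phi> (2, 3) = 0"
    and "\<forall>e\<in>set pendant_K5_minus. \<phi> e < 5"
    and "\<forall>e\<in>set pendant_K5_minus. \<forall>f\<in>set pendant_K5_minus. e \<noteq> f \<and> meets e f \<longrightarrow> \<phi> e \<noteq> \<phi> f"
  obtains e0 e1 e2 e3 e4 where
    "{e0, e1, e2, e3, e4} \<subseteq> set pendant_K5_minus"
    "\<phi> e0 = 0" "\<phi> e1 = 1" "\<phi> e2 = 2" "\<phi> e3 = 3" "\<phi> e4 = 4"
    "meets e0 e1" "meets e1 e2" "meets e2 e3" "meets e3 e4" "meets e4 e0"
proof -
  have E: "set pendant_K5_minus = insert (2, 3) (set (tl pendant_K5_minus))"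
    by (simp add: pendant_K5_minus_def)
  have "distinct (tl pendant_K5_minus @ map fst [((2, 3), 0)])"
    by (simp add: pendant_K5_minus_def)
  then have "has_tight_cycle (rev (map (\<lambda>e. (e, \<phi> e)) (tl pendant_K5_minus)) @ [((2, 3), 0)])"
    using assms unfolding E
    by (intro all_extensions_tightD all_extensions_tight_pendant_K5_minus) auto
  then have "has_tight_cycle (rev (map (\<lambda>e. (e, \<phi> e)) pendant_K5_minus))"
    using assms(1) by (simp add: pendant_K5_minus_def)
  then obtain e0 e1 e2 e3 e4 where
    "{e0, e1, e2, e3, e4} \<subseteq> set pendant_K5_minus"
    "\<phi> e0 = 0" "\<phi> e1 = 1" "\<phi> e2 = 2" "\<phi> e3 = 3" "\<phi> e4 = 4"
    "meets e0 e1" "meets e1 e2" "meets e2 e3" "meets e3 e4" "meets e4 e0"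
    by (auto simp: has_tight_cycle_def list_ex_iff)
  then show thesis by (rule that)
qed

section \<open>The lower bound 5\<close>

definition edge_set :: "nat \<times> nat \<Rightarrow> nat set" where
  "edge_set e = {fst e, snd e}"

lemma circular_edge_colouring_ge_5:
  assumes c: "circular_edge_colouring G r c"
    and sub: "edge_set ` set pendant_K5_minus \<subseteq> edges G"
  shows "5 \<le> r"
proof (rule ccontr)
  assume "\<not> 5 \<le> r"
  then have r: "r < 5" by simp
  \<comment> \<open>Rotating the circle of circumference \<open>r\<close> so that edge \<open>{2, 3}\<close> gets colour 0 cuts the case analysis
    down to colourings with that property.\<close>
  define d where "d e = (let x = c (edge_set e) - c {2, 3} in if x < 0 then x + r else x)" for e
  define \<phi> where "\<phi> e = nat \<lfloor>d e\<rfloor>" for e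
  let ?E = "set pendant_K5_minus"
  have crange: "0 \<le> c (edge_set e)" "c (edge_set e) < r" if "e \<in> ?E" for e
    using c sub that unfolding circular_edge_colouring_def by blast+
  have "0 \<le> c {2, 3}" "c {2, 3} < r"
    using crange[of "(2, 3)"] by (simp_all add: pendant_K5_minus_def edge_set_def)
  then have range: "0 \<le> d e" "d e < r" if "e \<in> ?E" for e
    using crange[OF that] by (auto simp: d_def Let_def)
  have inj: "inj_on edge_set ?E"
    by (simp add: pendant_K5_minus_def inj_on_def edge_set_def doubleton_eq_iff)
  have adj: "1 \<le> \<bar>d e - d f\<bar>" "\<bar>d e - d f\<bar> \<le> r - 1"
    if "e \<in> ?E" "f \<in> ?E" "e \<noteq> f" "meets e f" for e f
  proof -
    have "edge_set e \<in> edges G" "edge_set f \<in> edges G" "edge_set e \<noteq> edge_set f"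
      using that sub inj by (auto dest: inj_onD)
    moreover have "edge_set e \<inter> edge_set f \<noteq> {}"
      using that(4) by (auto simp: meets_def edge_set_def)
    ultimately have "1 \<le> \<bar>c (edge_set e) - c (edge_set f)\<bar>"
      "\<bar>c (edge_set e) - c (edge_set f)\<bar> \<le> r - 1"
      using c unfolding circular_edge_colouring_def by blast+
    \<comment> \<open>If exactly one of the two colours wraps round, the distance x becomes r - x,
      which exchanges the bounds 1 and r - 1; otherwise it is unchanged.\<close>
    then show "1 \<le> \<bar>d e - d f\<bar>" "\<bar>d e - d f\<bar> \<le> r - 1"
      using crange[OF that(1)] crange[OF that(2)] unfolding d_def Let_def
      by (auto split: if_splits)
  qed
  have less5: "\<phi> e < 5" if "e \<in> ?E" for e
    using range[OF that] r unfolding \<phi>_def by linarith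
  have proper: "\<phi> e \<noteq> \<phi> f" if "e \<in> ?E" "f \<in> ?E" "e \<noteq> f" "meets e f" for e f
    using adj(1)[OF that] range[OF that(1)] range[OF that(2)] unfolding \<phi>_def by linarith
  obtain e0 e1 e2 e3 e4 where e:
    "{e0, e1, e2, e3, e4} \<subseteq> ?E"
    "\<phi> e0 = 0" "\<phi> e1 = 1" "\<phi> e2 = 2" "\<phi> e3 = 3" "\<phi> e4 = 4"
    "meets e0 e1" "meets e1 e2" "meets e2 e3" "meets e3 e4" "meets e4 e0"
  proof (rule pendant_K5_minus_tight_cycle[of \<phi>])
    show "\<phi> (2, 3) = 0" by (simp add: \<phi>_def d_def edge_set_def)
  qed (use less5 proper in blast)+
  \<comment> \<open>Consecutive floors give \<open>d e < d f\<close>, which fixes the sign inside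
    the absolute value.\<close>
  have step: "d e + 1 \<le> d f" if "e \<in> ?E" "f \<in> ?E" "meets e f" "\<phi> f = \<phi> e + 1" for e f
  proof -
    have "1 \<le> \<bar>d e - d f\<bar>"
      using that by (intro adj) auto
    then show ?thesis
      using that(4) range[OF that(1)] range[OF that(2)] unfolding \<phi>_def by linarith
  qed
  have "d e0 + 1 \<le> d e1" "d e1 + 1 \<le> d e2" "d e2 + 1 \<le> d e3" "d e3 + 1 \<le> d e4"
    using e by (auto intro: step)
  moreover have "\<bar>d e4 - d e0\<bar> \<le> r - 1"
    using e by (intro adj) auto
  ultimately show False
    using r by linarith
qed

section \<open>The rings and their regularity\<close>

text \<open>
  The vertex \<open>5 * i + j\<close> is the copy of vertex \<open>j\<close> of \<open>K\<^sub>5\<close> in block \<open>i\<close>. Each vertex has exactly one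
  neighbour in every residue class modulo 5 other than its own.
\<close>

definition nbr :: "nat \<Rightarrow> nat \<Rightarrow> nat \<Rightarrow> nat" where
  "nbr n v k = 5 * (if v mod 5 = 1 \<and> k = 0 then Suc (v div 5) mod n
     else if v mod 5 = 0 \<and> k = 1 then (v div 5 + (n - 1)) mod n
     else v div 5) + k"

text \<open>The missing edge 01 of each copy is replaced by links from vertex 1 to vertex 0 of the
  next copy. In \<open>nbr\<close>, adding \<open>n - 1\<close> modulo \<open>n\<close> is the step
  back along the ring. For \<open>n = 1\<close> the link would restore the missing edge.\<close>

definition K5_ring :: "nat \<Rightarrow> nat graph" where
  "K5_ring n = ({..<5 * n}, {{v, nbr n v k} | v k. v < 5 * n \<and> k < 5 \<and> k \<noteq> v mod 5})"

lemma nbr_mod: "k < 5 \<Longrightarrow> nbr n v k mod 5 = k"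
  by (simp add: nbr_def)

lemma nbr_less:
  assumes "v < 5 * n" "k < 5"
  shows "nbr n v k < 5 * n"
proof -
  have n: "n > 0" using assms by simp
  have *: "5 * b + k < 5 * n" if "b < n" for b
    using that assms(2) by simp
  show ?thesis
    unfolding nbr_def using n assms(1) by (intro *) (auto simp: less_mult_imp_div_less mult.commute)
qed

lemma Suc_mod_plus_pred_mod:
  fixes i n :: nat
  assumes "i < n"
  shows "(Suc i mod n + (n - 1)) mod n = i"
  using assms by (cases "Suc i = n") auto

text \<open>Steps forward and back along the ring cancel, so adjacency by \<open>nbr\<close> is
  symmetric.\<close>

lemma nbr_nbr:
  assumes "v < 5 * n" "k < 5" "k \<noteq> v mod 5"
  shows "nbr n (nbr n v k) (v mod 5) = v"
proof -
  have n: "n > 0" and b: "v div 5 < n" using assms by auto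
  have m: "nbr n v k mod 5 = k"
    using assms by (simp add: nbr_mod)
  have d: "nbr n v k div 5 = (if v mod 5 = 1 \<and> k = 0 then Suc (v div 5) mod n
     else if v mod 5 = 0 \<and> k = 1 then (v div 5 + (n - 1)) mod n else v div 5)"
    using assms(2) by (simp add: nbr_def)
  have "(Suc (v div 5) mod n + (n - 1)) mod n = v div 5"
    using b by (rule Suc_mod_plus_pred_mod)
  moreover have "Suc ((v div 5 + (n - 1)) mod n) mod n = v div 5"
    using n b by (simp add: mod_Suc_eq)
  ultimately show ?thesis
    unfolding nbr_def[of n "nbr n v k"] m d using assms(3) mult_div_mod_eq[of 5 v]
    by (smt (verit, best))
qed

text \<open>An edge listed from its other end is also listed from \<open>v\<close>, by
  \<open>nbr_nbr\<close>.\<close>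

lemma K5_ring_edge_iff:
  assumes "v < 5 * n"
  shows "e \<in> edges (K5_ring n) \<and> v \<in> e \<longleftrightarrow> (\<exists>k<5. k \<noteq> v mod 5 \<and> e = {v, nbr n v k})"
proof
  assume "e \<in> edges (K5_ring n) \<and> v \<in> e"
  then obtain w k where w: "w < 5 * n" "k < 5" "k \<noteq> w mod 5" "e = {w, nbr n w k}" "v \<in> e"
    by (auto simp: K5_ring_def)
  show "\<exists>k<5. k \<noteq> v mod 5 \<and> e = {v, nbr n v k}"
  proof (cases "v = w")
    case True
    then show ?thesis using w by blast
  next
    case False
    then have v: "v = nbr n w k" using w by simp
    then have "e = {v, nbr n v (w mod 5)}" "v mod 5 = k"
      using w nbr_nbr nbr_mod by (simp_all add: insert_commute)
    then show ?thesis using w by (intro exI[of _ "w mod 5"]) auto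
  qed
next
  assume "\<exists>k<5. k \<noteq> v mod 5 \<and> e = {v, nbr n v k}"
  then show "e \<in> edges (K5_ring n) \<and> v \<in> e"
    using assms by (auto simp: K5_ring_def)
qed

lemma simple_K5_ring: "simple_graph (K5_ring n)"
  unfolding simple_graph_def
proof (intro conjI ballI)
  show "finite (verts (K5_ring n))" by (simp add: K5_ring_def)
  fix e assume "e \<in> edges (K5_ring n)"
  then obtain v k where e: "v < 5 * n" "k < 5" "k \<noteq> v mod 5" "e = {v, nbr n v k}"
    by (auto simp: K5_ring_def)
  then have "v \<noteq> nbr n v k" using nbr_mod by metis
  then show "card e = 2" using e by simp
  show "e \<subseteq> verts (K5_ring n)" using e nbr_less by (simp add: K5_ring_def)
qed

text \<open>The neighbours of a vertex lie one in each of the four other residue classes, so the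
  four edges to them are distinct.\<close>

lemma regular_K5_ring: "k_regular 4 (K5_ring n)"
  unfolding k_regular_def vertex_degree_def
proof
  fix v assume "v \<in> verts (K5_ring n)"
  then have v: "v < 5 * n" by (simp add: K5_ring_def)
  have "inj_on (\<lambda>k. {v, nbr n v k}) ({..<5} - {v mod 5})"
    by (rule inj_onI) (metis DiffD1 doubleton_eq_iff lessThan_iff nbr_mod)
  moreover have "{e \<in> edges (K5_ring n). v \<in> e} = (\<lambda>k. {v, nbr n v k}) ` ({..<5} - {v mod 5})"
    using K5_ring_edge_iff[OF v] by (auto simp: set_eq_iff)
  ultimately show "card {e \<in> edges (K5_ring n). v \<in> e} = 4"
    by (simp add: card_image)
qed

section \<open>The circular chromatic index of the rings\<close>

lemma mod_add_left_imp_eq: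
  fixes a k l m :: nat
  assumes "k < m" "l < m" "(a + k) mod m = (a + l) mod m"
  shows "k = l"
  using assms
proof (induction k l rule: linorder_wlog)
  case (le k l)
  then have "m dvd l - k"
    using mod_eq_dvd_iff_nat[of "a + k" "a + l" m] by simp
  then show ?case
    using le by (auto dest: dvd_imp_le)
qed simp

text \<open>The edges at \<open>v\<close> get the colours v + k modulo 5 for distinct residues k,
  hence distinct integers from 0 to 4, which differ by at least 1 and at most 4.\<close>

lemma circular_edge_colouring_K5_ring:
  "circular_edge_colouring (K5_ring n) 5 (\<lambda>e. real (\<Sum>e mod 5))"
  unfolding circular_edge_colouring_def
proof (intro conjI ballI impI)
  fix e f assume e: "e \<in> edges (K5_ring n)" and f: "f \<in> edges (K5_ring n)"
    and ef: "e \<noteq> f \<and> e \<inter> f \<noteq> {}"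
  then obtain v where v: "v \<in> e" "v \<in> f" by auto
  then have vn: "v < 5 * n"
    using e simple_K5_ring[of n] by (auto simp: simple_graph_def K5_ring_def)
  obtain k where k: "k < 5" "k \<noteq> v mod 5" "e = {v, nbr n v k}"
    using K5_ring_edge_iff[OF vn] e v by blast
  obtain l where l: "l < 5" "l \<noteq> v mod 5" "f = {v, nbr n v l}"
    using K5_ring_edge_iff[OF vn] f v by blast
  have sum: "\<Sum>{v, nbr n v j} mod 5 = (v mod 5 + j) mod 5" if "j < 5" "j \<noteq> v mod 5" for j
  proof -
    \<comment> \<open>The sum runs over a set, so the two ends must be distinct for both to
      count.\<close>
    have "nbr n v j \<noteq> v" using nbr_mod that by metis
    then have "\<Sum>{v, nbr n v j} mod 5 = (v mod 5 + nbr n v j mod 5) mod 5"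
      by (simp add: mod_add_eq)
    then show ?thesis using that by (simp add: nbr_mod)
  qed
  have "k \<noteq> l" using ef k l by auto
  moreover have "(v mod 5 + k) mod 5 \<noteq> (v mod 5 + l) mod 5"
    using \<open>k \<noteq> l\<close> k(1) l(1) mod_add_left_imp_eq by blast
  then have "\<Sum>e mod 5 \<noteq> \<Sum>f mod 5"
    using k l sum by metis
  moreover have "\<Sum>e mod 5 < 5" "\<Sum>f mod 5 < 5" by simp_all
  ultimately show "1 \<le> \<bar>real (\<Sum>e mod 5) - real (\<Sum>f mod 5)\<bar>"
    and "\<bar>real (\<Sum>e mod 5) - real (\<Sum>f mod 5)\<bar> \<le> 5 - 1"
    by linarith+
next
  show "0 \<le> real (\<Sum>e mod 5)" "real (\<Sum>e mod 5) < 5" for e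
    by simp_all
qed

lemma pendant_K5_minus_subset_K5_ring:
  assumes "n \<ge> 2"
  shows "edge_set ` set pendant_K5_minus \<subseteq> edges (K5_ring n)"
proof -
  have "edge_set (a, b) \<in> edges (K5_ring n)"
    if "a < 5" "b = nbr n a (b mod 5)" "b mod 5 \<noteq> a" for a b
  proof -
    have "a < 5 * n" using that(1) assms by simp
    moreover have "b mod 5 < 5 \<and> b mod 5 \<noteq> a mod 5 \<and> {a, b} = {a, nbr n a (b mod 5)}"
      using that by simp
    ultimately show ?thesis
      using K5_ring_edge_iff[of a n "{a, b}"] unfolding edge_set_def fst_conv snd_conv by blast
  qed
  from this[of 2 3] this[of 2 4] this[of 3 4] this[of 1 2] this[of 1 3] this[of 1 4]
    this[of 0 2] this[of 0 3] this[of 0 4] this[of 1 5]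
  show ?thesis
    using assms by (simp add: pendant_K5_minus_def nbr_def)
qed

lemma circular_chromatic_index_K5_ring:
  assumes "n \<ge> 2"
  shows "circular_chromatic_index (K5_ring n) = 5"
  unfolding circular_chromatic_index_def
proof (rule cInf_eq_minimum)
  show "5 \<in> {r. \<exists>c. circular_edge_colouring (K5_ring n) r c}"
    using circular_edge_colouring_K5_ring by blast
  show "5 \<le> r" if "r \<in> {r. \<exists>c. circular_edge_colouring (K5_ring n) r c}" for r
    using that circular_edge_colouring_ge_5 pendant_K5_minus_subset_K5_ring[OF assms] by blast
qed

section \<open>2-connectivity\<close>

text \<open>Each copy keeps a hub adjacent to all its other surviving vertices. At most one link of
  the ring is lost, and the remaining links still join all hubs in a path.\<close>

lemma connected_K5_ring_minus:
  assumes n: "n \<ge> 2" and X: "X \<subseteq> {x}"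
  shows "connected_graph (delete_verts (K5_ring n) X)"
proof -
  define R where "R = {(u, v). {u, v} \<in> edges (delete_verts (K5_ring n) X)}"
  have sym: "sym (R\<^sup>*)"
    unfolding R_def by (intro sym_rtrancl symI) (auto simp: insert_commute)
  have Rtrans: "(u, w) \<in> R\<^sup>*" if "(u, v) \<in> R\<^sup>*" "(w, v) \<in> R\<^sup>*" for u v w
    using that sym by (meson rtrancl_trans symD)
  have edgeI: "(u, v) \<in> R"
    if "k < 5" "u < 5 * n" "v = nbr n u k" "k \<noteq> u mod 5" "u \<notin> X" "v \<notin> X" for u v k
    using K5_ring_edge_iff[of u n "{u, v}"] that by (auto simp: R_def delete_verts_def)
  have inner: "(5 * i + j, 5 * i + k) \<in> R"
    if "i < n" "j < 5" "k < 5" "j \<noteq> k" "\<not> (j = 0 \<and> k = 1)" "\<not> (j = 1 \<and> k = 0)"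
      "5 * i + j \<notin> X" "5 * i + k \<notin> X" for i j k
  proof -
    have "nbr n (5 * i + j) k = 5 * i + k"
      using that by (auto simp: nbr_def)
    then show ?thesis
      using that by (intro edgeI[where k = k]) auto
  qed
  have Suc5: "Suc (5 * i) div 5 = i" "Suc (5 * i) mod 5 = 1" for i :: nat
    by presburger+
  have link: "(5 * i + 1, 5 * (Suc i mod n)) \<in> R"
    if "i < n" "5 * i + 1 \<notin> X" "5 * (Suc i mod n) \<notin> X" for i
    using that by (intro edgeI[where k = 0]) (auto simp: nbr_def Suc5)
  \<comment> \<open>Vertices 2 and 3 are not ends of the missing edge, and at most one of them is
    deleted.\<close>
  define t where "t i = (if 5 * i + 2 \<in> X then 3 else 2 :: nat)" for i
  define h where "h i = 5 * i + t i" for i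
  have t: "t i < 5" "t i \<noteq> 0" "t i \<noteq> 1" "5 * i + t i \<notin> X" for i
  proof -
    have "\<not> (5 * i + 2 \<in> X \<and> 5 * i + 3 \<in> X)"
      using X by (metis add_left_cancel numeral_eq_iff semiring_norm(89) singletonD subsetD)
    then show "5 * i + t i \<notin> X" by (auto simp: t_def)
  qed (simp_all add: t_def)
  have hub: "(5 * i + j, h i) \<in> R\<^sup>*" if "i < n" "j < 5" "5 * i + j \<notin> X" for i j
  proof (cases "j = t i")
    case True
    then show ?thesis by (simp add: h_def)
  next
    case False
    then show ?thesis
      unfolding h_def using that t[of i] by (intro r_into_rtrancl inner) auto
  qed
  have hlink: "(h i, h (Suc i mod n)) \<in> R\<^sup>*"
    if "i < n" "5 * i + 1 \<notin> X" "5 * (Suc i mod n) \<notin> X" for i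
  proof -
    have "(h i, 5 * i + 1) \<in> R\<^sup>*"
      using hub[of i 1] that sym by (auto dest: symD)
    also have "(5 * i + 1, 5 * (Suc i mod n)) \<in> R" using link that by blast
    also have "(5 * (Suc i mod n), h (Suc i mod n)) \<in> R\<^sup>*"
      using hub[of "Suc i mod n" 0] that by simp
    finally show ?thesis .
  qed
  obtain l where l: "l < n"
    and ok: "\<And>i. i < n \<Longrightarrow> i \<noteq> l \<Longrightarrow> 5 * i + 1 \<notin> X \<and> 5 * (Suc i mod n) \<notin> X"
  proof (rule that)
    \<comment> \<open>A deleted vertex 0 breaks the link entering its copy, a deleted vertex 1 the
      link leaving it. For other \<open>x\<close> no link breaks and any index serves; the reduction
      modulo \<open>n\<close> keeps it below \<open>n\<close>.\<close>
    let ?l = "if x mod 5 = 0 then (x div 5 + (n - 1)) mod n else x div 5 mod n"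
    show "?l < n" using n by simp
    fix i assume i: "i < n" "i \<noteq> ?l"
    have "5 * i + 1 \<noteq> x"
      using i by (auto simp: Suc5)
    moreover have "5 * (Suc i mod n) \<noteq> x"
      using i Suc_mod_plus_pred_mod[OF i(1)] by auto
    ultimately show "5 * i + 1 \<notin> X \<and> 5 * (Suc i mod n) \<notin> X"
      using X by auto
  qed
  \<comment> \<open>Starting just after the broken link \<open>l\<close>, fewer than
    \<open>n\<close> steps reach every copy without crossing it.\<close>
  have chain: "k < n \<Longrightarrow> (h (Suc l mod n), h ((Suc l + k) mod n)) \<in> R\<^sup>*" for k
  proof (induction k)
    case 0
    then show ?case by simp
  next
    case (Suc k)
    let ?i = "(Suc l + k) mod n"
    have "?i \<noteq> l"
      using Suc.prems l by (cases "Suc l + k < n") (auto simp: mod_if)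
    then have "(h ?i, h (Suc ?i mod n)) \<in> R\<^sup>*"
      using ok[of ?i] n by (intro hlink) auto
    then show ?case
      using Suc by (simp add: mod_Suc_eq)
  qed
  have all: "(u, h (Suc l mod n)) \<in> R\<^sup>*" if u: "u < 5 * n" "u \<notin> X" for u
  proof -
    let ?i = "u div 5"
    have i: "?i < n" using u by auto
    \<comment> \<open>Adding \<open>n\<close> prevents truncation of the subtraction, since
      \<open>Suc l \<le> n\<close>.\<close>
    let ?k = "(?i + n - Suc l) mod n"
    have "(Suc l + ?k) mod n = (Suc l + (?i + n - Suc l)) mod n"
      by (rule mod_add_right_eq)
    also have "\<dots> = ?i"
      using i l by simp
    finally have "(Suc l + ?k) mod n = ?i" .
    moreover have "?k < n" using n by simp
    ultimately have "(h (Suc l mod n), h ?i) \<in> R\<^sup>*"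
      using chain[of ?k] by simp
    moreover have "(u, h ?i) \<in> R\<^sup>*"
      using hub[of ?i "u mod 5"] i u by simp
    ultimately show ?thesis using Rtrans by blast
  qed
  have verts: "verts (delete_verts (K5_ring n) X) = {..<5 * n} - X"
    by (simp add: delete_verts_def K5_ring_def)
  have "h 0 \<in> {..<5 * n} - X"
    using n t[of 0] by (simp add: h_def)
  moreover have "(u, v) \<in> R\<^sup>*" if "u \<in> {..<5 * n} - X" "v \<in> {..<5 * n} - X" for u v
    by (rule Rtrans[OF all all]) (use that in auto)
  ultimately show ?thesis
    unfolding connected_graph_def R_def[symmetric] verts by blast
qed

lemma two_connected_K5_ring:
  assumes "n \<ge> 2"
  shows "k_connected 2 (K5_ring n)"
  unfolding k_connected_def
proof (intro conjI allI impI)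
  show "2 < card (verts (K5_ring n))"
    using assms by (simp add: K5_ring_def)
  fix X assume "X \<subseteq> verts (K5_ring n)" "card X < 2"
  then have "finite X" "card X \<le> 1"
    by (auto simp: K5_ring_def intro: finite_subset)
  then obtain x where "X \<subseteq> {x}"
    by (metis card_1_singletonE card_0_eq empty_subsetI le_eq_less_or_eq less_one order_refl)
  then show "connected_graph (delete_verts (K5_ring n) X)"
    using connected_K5_ring_minus assms by blast
qed

section \<open>An infinite family of pairwise non-isomorphic rings\<close>

lemma graph_isomorphic_K5_ringD:
  assumes "graph_isomorphic (K5_ring m) (K5_ring n)"
  shows "m = n"
proof -
  have "card (verts (K5_ring m)) = card (verts (K5_ring n))"
    using assms by (auto simp: graph_isomorphic_def intro: bij_betw_same_card)
  then show ?thesis by (simp add: K5_ring_def)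
qed

theorem theorem6:
  "\<exists>\<G> :: nat graph set. infinite \<G> \<and>
     (\<forall>G\<in>\<G>. simple_graph G \<and> k_connected 2 G \<and> k_regular 4 G \<and>
        circular_chromatic_index G = 5) \<and>
     (\<forall>G\<in>\<G>. \<forall>H\<in>\<G>. G \<noteq> H \<longrightarrow> \<not> graph_isomorphic G H)"
proof -
  have "inj K5_ring"
    by (rule injI) (simp add: K5_ring_def)
  then have "infinite (K5_ring ` {2..})"
    by (meson finite_imageD infinite_Ici inj_on_subset subset_UNIV)
  moreover have "\<forall>G\<in>K5_ring ` {2..}. simple_graph G \<and> k_connected 2 G \<and> k_regular 4 G \<and>
      circular_chromatic_index G = 5"
    by (simp add: simple_K5_ring two_connected_K5_ring regular_K5_ring circular_chromatic_index_K5_ring)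
  moreover have "\<forall>G\<in>K5_ring ` {2..}. \<forall>H\<in>K5_ring ` {2..}. G \<noteq> H \<longrightarrow> \<not> graph_isomorphic G H"
    using graph_isomorphic_K5_ringD by blast
  ultimately show ?thesis by blast
qed

end
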